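(* Let $n,m,r$ be non-negative integers and $p$ a prime number. Then $$\sum_{k=0}^{p-1}(-m)_{p-1-k}\,(x+1)^k\,\mathcal{F}_n(x;r+m,k)\equiv -r^n\,\mathcal{T}_{p-1}(x;m)\pmod{p\mathbb{Z}_p[x]}.$$
   Context: $(\alpha)_j=\alpha(\alpha-1)\cdots(\alpha-j+1)$ for $j\ge1$, $(\alpha)_0=1$. ${n\brace k}_r$ denotes the $r$-Stirling numbers of the second kind: the number of partitions of $\{1,\dots,n\}$ into $k$ nonempty blocks such that $1,\dots,r$ lie in distinct blocks. The $(r,s)$-Fubini polynomials are $\mathcal{F}_n(x;r,s)=\sum_{k=0}^n {n+r\brace k+r}_r (k+s)!\,x^k$. The polynomials $\mathcal{T}_n$ are $\mathcal{T}_n(x;r)=\sum_{j=0}^n\binom{n+r}{j+r}x^j$. Convention $0^0=1$. $A\equiv B\pmod{p\mathbb{Z}_p[x]}$ means corresponding coefficients are congruent modulo $p$. *)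

theory Defs
  imports
    "HOL-Computational_Algebra.Computational_Algebra"
    "HOL-Number_Theory.Cong"
    "HOL-Library.Disjoint_Sets"
begin

definition falling_fact :: "'a::comm_ring_1 \<Rightarrow> nat \<Rightarrow> 'a" where
  "falling_fact a j = (\<Prod>i<j. a - of_nat i)"

text \<open>
  The map \<open>f\<close> assigns to each of \<open>1, \<dots>, r\<close> its block; injectivity says that these blocks
  are distinct. In particular the number is \<open>0\<close> for \<open>n < r\<close>.
\<close>

definition r_Stirling2 :: "nat \<Rightarrow> nat \<Rightarrow> nat \<Rightarrow> nat" where
  "r_Stirling2 r n k =
     card {P. partition_on {1..n} P \<and> card P = k \<and>
              (\<exists>f. inj_on f {1..r} \<and> (\<forall>i\<in>{1..r}. f i \<in> P \<and> i \<in> f i))}"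

definition Fubini_poly :: "nat \<Rightarrow> nat \<Rightarrow> nat \<Rightarrow> int poly" where
  "Fubini_poly n r s =
     (\<Sum>k\<le>n. monom (of_nat (r_Stirling2 r (n + r) (k + r)) * fact (k + s)) k)"

definition T_poly :: "nat \<Rightarrow> nat \<Rightarrow> int poly" where
  "T_poly n r = (\<Sum>j\<le>n. monom (of_nat ((n + r) choose (j + r))) j)"

text \<open>
  Integers are congruent modulo \<open>p\<close> in the \<open>p\<close>-adic integers iff they are congruent modulo \<open>p\<close>
  in the integers, so for integer polynomials this is congruence modulo \<open>p\<int>\<^sub>p[x]\<close>.
\<close>

definition poly_cong :: "nat \<Rightarrow> int poly \<Rightarrow> int poly \<Rightarrow> bool" where
  "poly_cong p A B \<longleftrightarrow> (\<forall>i. [coeff A i = coeff B i] (mod int p))"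

end

theory Submission
  imports "HOL-Number_Theory.Residues" Defs
begin

text \<open>
  Write \<open>y = x + 1\<close>, \<open>R = r + m\<close> and \<open>B\<^sub>j = \<Sum>k<p. (-m)\<^sub>p\<^sub>-\<^sub>1\<^sub>-\<^sub>k (k + j)! y\<^sup>k\<close>. Expanding the Fubini polynomials
  turns the left-hand side into \<open>\<Sum>j. S\<^sub>R(n + R, j + R) x\<^sup>j B\<^sub>j\<close>. Modulo \<open>p\<close>, shifting the summation
  index gives \<open>x B\<^sub>j\<^sub>+\<^sub>1 \<equiv> (-m - j) B\<^sub>j\<close>; the boundary terms vanish because they contain \<open>(p + j)!\<close>
  or \<open>(-m)\<^sub>p\<close>. Hence \<open>x\<^sup>j B\<^sub>j \<equiv> (-m)\<^sub>j B\<^sub>0\<close>, and the identity \<open>\<Sum>j. S\<^sub>R(n + R, j + R) (t)\<^sub>j = (t + R)\<^sup>n\<close> at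
  \<open>t = -m\<close> leaves \<open>r\<^sup>n B\<^sub>0\<close>. Finally, \<open>T\<^sub>p\<^sub>-\<^sub>1(x; m) = \<Sum>k<p. binom(m + i - 1, i) y\<^sup>k\<close> with
  \<open>i = p - 1 - k\<close>, and \<open>B\<^sub>0 \<equiv> -T\<^sub>p\<^sub>-\<^sub>1(x; m)\<close> follows termwise from \<open>(-1)\<^sup>i i! (p - 1 - i)! \<equiv> -1\<close>.
\<close>

section \<open>Set partitions that keep a distinguished subset apart\<close>

text \<open>An arbitrary distinguished set \<open>R\<close> in place of \<open>{1..r}\<close>
  permits induction over the remaining elements.\<close>

definition separating_partitions :: "'a set \<Rightarrow> 'a set \<Rightarrow> 'a set set set" where
  "separating_partitions A R =
     {P. partition_on A P \<and> (\<forall>B\<in>P. \<forall>x\<in>B \<inter> R. \<forall>y\<in>B \<inter> R. x = y)}"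

lemma finite_separating_partitions:
  "finite A \<Longrightarrow> finite (separating_partitions A R)"
  unfolding separating_partitions_def
  by (rule finite_subset[OF _ finitely_many_partition_on]) auto

lemma separating_partitions_self: "separating_partitions R R = {(\<lambda>x. {x}) ` R}"
proof
  show "{(\<lambda>x. {x}) ` R} \<subseteq> separating_partitions R R"
    by (auto simp: separating_partitions_def partition_on_singletons)
  show "separating_partitions R R \<subseteq> {(\<lambda>x. {x}) ` R}"
  proof
    fix P assume "P \<in> separating_partitions R R"
    then have P: "partition_on R P" and sep: "\<And>B x y. B \<in> P \<Longrightarrow> x \<in> B \<inter> R \<Longrightarrow> y \<in> B \<inter> R \<Longrightarrow> x = y"
      by (auto simp: separating_partitions_def)
    have block: "B = {x}" if "B \<in> P" "x \<in> B" for B x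
      using sep[OF that(1)] that partition_onD1[OF P] by blast
    have "P = (\<lambda>x. {x}) ` R"
    proof (intro equalityI subsetI)
      fix B assume "B \<in> P"
      moreover from this obtain x where "x \<in> B"
        using partition_onD3[OF P] by fastforce
      ultimately show "B \<in> (\<lambda>x. {x}) ` R"
        using block[of B x] partition_onD1[OF P] by blast
    next
      fix B assume "B \<in> (\<lambda>x. {x}) ` R"
      then obtain x where x: "x \<in> R" "B = {x}" by blast
      then obtain C where "C \<in> P" "x \<in> C"
        using partition_onD1[OF P] by blast
      then show "B \<in> P" using block[of C x] x by simp
    qed
    then show "P \<in> {(\<lambda>x. {x}) ` R}" by simp
  qed
qed

text \<open>Sending each element of \<open>R\<close> to its block is injective. This makes the
  truncated difference \<open>card P - card R\<close> exact.\<close>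

lemma card_le_card_separating_partition:
  assumes "finite A" "R \<subseteq> A" "P \<in> separating_partitions A R"
  shows "card R \<le> card P"
proof -
  have P: "partition_on A P" and sep: "\<And>B x y. B \<in> P \<Longrightarrow> x \<in> B \<inter> R \<Longrightarrow> y \<in> B \<inter> R \<Longrightarrow> x = y"
    using assms(3) by (auto simp: separating_partitions_def)
  have "\<forall>x\<in>R. \<exists>B\<in>P. x \<in> B"
    using assms(2) partition_onD1[OF P] by blast
  then obtain f where f: "\<And>x. x \<in> R \<Longrightarrow> f x \<in> P \<and> x \<in> f x" by metis
  have "inj_on f R"
    by (rule inj_onI) (metis IntI f sep)
  then show ?thesis
    using card_inj_on_le[of f R P] f finite_elements[OF assms(1) P] by blast
qed

text \<open>The empty set stands for the choice of putting \<open>a\<close> into a block of its own.\<close>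

lemma bij_betw_separating_partitions_insert:
  assumes "a \<notin> A" "R \<subseteq> A"
  shows "bij_betw (\<lambda>(P, B). insert (insert a B) (P - {B}))
           (SIGMA P : separating_partitions A R. insert {} P)
           (separating_partitions (insert a A) R)"
proof -
  let ?h = "\<lambda>(P, B). insert (insert a B) (P - {B})"
  \<comment> \<open>\<open>?block Q\<close> is the one block containing \<open>a\<close>. The
    inverse \<open>?g\<close> takes \<open>a\<close> out of it; \<open>- {{}}\<close> discards the
    remainder when \<open>a\<close> was alone.\<close>
  let ?block = "\<lambda>Q. \<Union>{C \<in> Q. a \<in> C}"
  let ?g = "\<lambda>Q. (insert (?block Q - {a}) (Q - {?block Q}) - {{}}, ?block Q - {a})"
  show ?thesis
  proof (rule bij_betw_byWitness[where f' = ?g])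
    show "\<forall>u\<in>SIGMA P : separating_partitions A R. insert {} P. ?g (?h u) = u"
    proof
      fix u assume "u \<in> (SIGMA P : separating_partitions A R. insert {} P)"
      then obtain P B where u: "u = (P, B)"
        and PB: "P \<in> separating_partitions A R" "B = {} \<or> B \<in> P" by auto
      then have P: "partition_on A P" by (auto simp: separating_partitions_def)
      have aP: "a \<notin> C" if "C \<in> P" for C
        using that assms(1) partition_onD1[OF P] by blast
      have aB: "a \<notin> B" using PB aP by auto
      have "{C \<in> ?h (P, B). a \<in> C} = {insert a B}"
        using aP by auto
      then have blk: "?block (?h (P, B)) = insert a B" by simp
      have "?h (P, B) - {insert a B} = P - {B}" using aP by auto
      moreover have "insert B (P - {B}) - {{}} = P"
        using PB partition_onD3[OF P] by auto
      moreover have "insert a B - {a} = B" using aB by auto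
      ultimately show "?g (?h u) = u"
        unfolding u blk by simp
    qed
    have blockE: "\<exists>C. C \<in> Q \<and> a \<in> C \<and> ?block Q = C \<and> (\<forall>D\<in>Q - {C}. C \<inter> D = {})"
      if Q: "partition_on (insert a A) Q" for Q
    proof -
      obtain C where C: "C \<in> Q" "a \<in> C" using partition_onD1[OF Q] by blast
      have dis: "\<forall>D\<in>Q - {C}. C \<inter> D = {}"
        using partition_onD2[OF Q] C by (auto simp: disjoint_def)
      then have "{C \<in> Q. a \<in> C} = {C}" using C by auto
      then show ?thesis using C dis by auto
    qed
    show "\<forall>Q\<in>separating_partitions (insert a A) R. ?h (?g Q) = Q"
    proof
      fix Q assume "Q \<in> separating_partitions (insert a A) R"
      then have Q: "partition_on (insert a A) Q" by (auto simp: separating_partitions_def)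
      then obtain C where C: "C \<in> Q" "a \<in> C" "?block Q = C" and dis: "\<forall>D\<in>Q - {C}. C \<inter> D = {}"
        using blockE by blast
      \<comment> \<open>Another block equal to \<open>C - {a}\<close> would be contained in
        \<open>C\<close> and disjoint from it, hence empty. So \<open>?h\<close> removes only what
        \<open>?g\<close> inserted.\<close>
      have "D \<noteq> C - {a}" if "D \<in> Q - {C}" for D
      proof
        assume "D = C - {a}"
        then have "C \<inter> D = D" by auto
        then show False using bspec[OF dis that] that partition_onD3[OF Q] by simp
      qed
      then have "insert (C - {a}) (Q - {C}) - {{}} - {C - {a}} = Q - {C}"
        using partition_onD3[OF Q] by auto
      moreover have "insert a (C - {a}) = C" using C by auto
      ultimately show "?h (?g Q) = Q" unfolding C(3) using C(1) by auto
    qed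
    show "?h ` (SIGMA P : separating_partitions A R. insert {} P) \<subseteq> separating_partitions (insert a A) R"
    proof (rule image_subsetI)
      fix u assume "u \<in> (SIGMA P : separating_partitions A R. insert {} P)"
      then obtain P B where u: "u = (P, B)"
        and PB: "P \<in> separating_partitions A R" "B = {} \<or> B \<in> P" by auto
      then have P: "partition_on A P" and sep: "\<forall>B\<in>P. \<forall>x\<in>B \<inter> R. \<forall>y\<in>B \<inter> R. x = y"
        by (auto simp: separating_partitions_def)
      have "partition_on (insert a A) (insert (insert a B) (P - {B}))"
      proof (rule partition_onI)
        show "\<Union>(insert (insert a B) (P - {B})) = insert a A"
          using PB partition_onD1[OF P] by auto
        show "{} \<notin> insert (insert a B) (P - {B})"
          using partition_onD3[OF P] by auto
        have *: "disjnt C D" if "C \<in> P" "D \<in> P" "C \<noteq> D" for C D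
          using partition_onD2[OF P] that by (auto simp: pairwise_def)
        have "disjnt (insert a B) D" if "D \<in> P - {B}" for D
          using that PB(2) *[of B D] assms(1) partition_onD1[OF P] by (auto simp: disjnt_def)
        then show "disjnt C D" if "C \<in> insert (insert a B) (P - {B})"
          "D \<in> insert (insert a B) (P - {B})" "C \<noteq> D" for C D
          using that * by (metis DiffE disjnt_sym insertE)
      qed
      \<comment> \<open>As \<open>a\<close> lies outside \<open>R\<close>, adding it to
        \<open>B\<close> does not change the intersection with \<open>R\<close>.\<close>
      moreover have "\<forall>C\<in>insert (insert a B) (P - {B}). \<forall>x\<in>C \<inter> R. \<forall>y\<in>C \<inter> R. x = y"
        using sep PB(2) assms by blast
      ultimately show "?h u \<in> separating_partitions (insert a A) R"
        by (simp add: u separating_partitions_def)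
    qed
    show "?g ` separating_partitions (insert a A) R \<subseteq> (SIGMA P : separating_partitions A R. insert {} P)"
    proof (rule image_subsetI)
      fix Q assume "Q \<in> separating_partitions (insert a A) R"
      then have Q: "partition_on (insert a A) Q" and sep: "\<forall>B\<in>Q. \<forall>x\<in>B \<inter> R. \<forall>y\<in>B \<inter> R. x = y"
        by (auto simp: separating_partitions_def)
      obtain C where C: "C \<in> Q" "a \<in> C" "?block Q = C" and dis: "\<forall>D\<in>Q - {C}. C \<inter> D = {}"
        using blockE[OF Q] by blast
      let ?P = "insert (C - {a}) (Q - {C}) - {{}}"
      have "partition_on A ?P"
      proof (rule partition_onI)
        show "\<Union>?P = A"
        proof -
          have "\<Union>?P = (C - {a}) \<union> \<Union>(Q - {C})" by auto
          also have "\<dots> = \<Union>Q - {a}" using C(1,2) dis by auto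
          also have "\<dots> = A" using partition_onD1[OF Q] assms(1) by auto
          finally show ?thesis .
        qed
        show "{} \<notin> ?P" by simp
        have *: "disjnt C D" if "C \<in> Q" "D \<in> Q" "C \<noteq> D" for C D
          using partition_onD2[OF Q] that by (auto simp: pairwise_def)
        have "disjnt (C - {a}) D" if "D \<in> Q - {C}" for D
          using that dis by (auto simp: disjnt_def)
        then show "disjnt D E" if "D \<in> ?P" "E \<in> ?P" "D \<noteq> E" for D E
          using that * by (metis DiffE DiffI disjnt_sym insertE singletonD)
      qed
      moreover have "\<forall>B\<in>?P. \<forall>x\<in>B \<inter> R. \<forall>y\<in>B \<inter> R. x = y"
        using sep C(1) by blast
      ultimately have "?P \<in> separating_partitions A R"
        by (simp add: separating_partitions_def)
      then show "?g Q \<in> (SIGMA P : separating_partitions A R. insert {} P)"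
        unfolding C(3) by auto
    qed
  qed
qed

section \<open>Powers expanded in falling factorials with r-Stirling coefficients\<close>

lemma falling_fact_0 [simp]: "falling_fact t 0 = 1"
  by (simp add: falling_fact_def)

lemma falling_fact_Suc: "falling_fact t (Suc j) = falling_fact t j * (t - of_nat j)"
  by (simp add: falling_fact_def)

text \<open>A new element either joins one of the \<open>card P\<close> blocks, leaving the weight
  unchanged, or forms its own block, multiplying the weight by \<open>t - (card P - card R)\<close>.
  Together this gives the factor \<open>t + card R\<close>, the same for every
  \<open>P\<close>.\<close>

lemma sum_falling_fact_separating_partitions:
  fixes t :: "'a::comm_ring_1"
  assumes "finite R" "finite S" "S \<inter> R = {}"
  shows "(\<Sum>P\<in>separating_partitions (S \<union> R) R. falling_fact t (card P - card R))
           = (t + of_nat (card R)) ^ card S"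
  using assms(2,3)
proof (induction S rule: finite_induct)
  case empty
  show ?case
    by (simp add: separating_partitions_self card_image)
next
  case (insert a S)
  let ?A = "S \<union> R" and ?f = "\<lambda>P. falling_fact t (card P - card R)"
  have fin: "finite ?A" using assms(1) insert.hyps by simp
  have a: "a \<notin> ?A" using insert by auto
  have "(\<Sum>P\<in>separating_partitions (insert a ?A) R. ?f P) =
        (\<Sum>(P, B)\<in>(SIGMA P : separating_partitions ?A R. insert {} P).
           ?f (insert (insert a B) (P - {B})))"
    using sum.reindex_bij_betw[OF bij_betw_separating_partitions_insert[OF a], of R ?f]
    by (simp add: case_prod_unfold)
  also have "\<dots> = (\<Sum>P\<in>separating_partitions ?A R. \<Sum>B\<in>insert {} P.
                    ?f (insert (insert a B) (P - {B})))"
  proof (rule sum.Sigma[symmetric, OF finite_separating_partitions[OF fin]], rule ballI)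
    fix P assume "P \<in> separating_partitions ?A R"
    then show "finite (insert {} P)"
      using finite_elements[OF fin] by (auto simp: separating_partitions_def)
  qed
  also have "\<dots> = (\<Sum>P\<in>separating_partitions ?A R. ?f P * (t + of_nat (card R)))"
  proof (rule sum.cong[OF refl])
    fix P assume P: "P \<in> separating_partitions ?A R"
    then have part: "partition_on ?A P" by (simp add: separating_partitions_def)
    note finP = finite_elements[OF fin part]
    have new: "insert a B \<notin> P" for B using partition_onD1[OF part] a by blast
    have card_P: "card R \<le> card P"
      by (rule card_le_card_separating_partition[OF fin _ P]) simp
    have empty: "{} \<notin> P" by (rule partition_onD3[OF part])
    have "(\<Sum>B\<in>insert {} P. ?f (insert (insert a B) (P - {B}))) =
          ?f (insert {a} P) + (\<Sum>B\<in>P. ?f (insert (insert a B) (P - {B})))"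
      using finP empty by simp
    also have "(\<Sum>B\<in>P. ?f (insert (insert a B) (P - {B}))) = (\<Sum>B\<in>P. ?f P)"
    proof (rule sum.cong[OF refl])
      fix B assume "B \<in> P"
      then have "card (insert (insert a B) (P - {B})) = card P"
        using finP new card_Suc_Diff1[of P B] by simp
      then show "?f (insert (insert a B) (P - {B})) = ?f P" by simp
    qed
    also have "card (insert {a} P) - card R = Suc (card P - card R)"
      using finP new card_P by (simp add: Suc_diff_le)
    finally show "(\<Sum>B\<in>insert {} P. ?f (insert (insert a B) (P - {B}))) =
                  ?f P * (t + of_nat (card R))"
      using card_P by (simp add: falling_fact_Suc of_nat_diff algebra_simps)
  qed
  also have "\<dots> = (t + of_nat (card R)) ^ card (insert a S)"
    using insert by (simp add: sum_distrib_right[symmetric])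
  finally show ?case by simp
qed

text \<open>The function \<open>f\<close> must send \<open>i\<close> to the unique block containing
  it, so its injectivity is exactly separation; \<open>r \<le> n\<close> provides a block for each
  \<open>i\<close>.\<close>

lemma r_Stirling2_eq_card_separating_partitions:
  assumes "r \<le> n"
  shows "r_Stirling2 r n k = card {P \<in> separating_partitions {1..n} {1..r}. card P = k}"
proof -
  have eq: "(\<exists>f. inj_on f {1..r} \<and> (\<forall>i\<in>{1..r}. f i \<in> P \<and> i \<in> f i)) \<longleftrightarrow>
        (\<forall>B\<in>P. \<forall>x\<in>B \<inter> {1..r}. \<forall>y\<in>B \<inter> {1..r}. x = y)" (is "?L \<longleftrightarrow> ?R")
    if P: "partition_on {1..n} P" for P
  proof
    assume ?L
    then obtain f where f: "inj_on f {1..r}" "\<And>i. i \<in> {1..r} \<Longrightarrow> f i \<in> P \<and> i \<in> f i" by blast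
    have "f x = B" if "B \<in> P" "x \<in> B \<inter> {1..r}" for B x
      using partition_onD2[OF P] f(2)[of x] that by (auto simp: disjoint_def)
    then show ?R using inj_onD[OF f(1)] by blast
  next
    assume R: ?R
    have "\<forall>x\<in>{1..r}. \<exists>B\<in>P. x \<in> B"
      using assms partition_onD1[OF P] by (metis UnionE atLeastAtMost_iff order_trans)
    then obtain f where f: "\<And>x. x \<in> {1..r} \<Longrightarrow> f x \<in> P \<and> x \<in> f x" by metis
    have "inj_on f {1..r}"
      by (rule inj_onI) (metis IntI R f)
    then show ?L using f by blast
  qed
  show ?thesis
    unfolding r_Stirling2_def separating_partitions_def mem_Collect_eq
    using eq by (intro arg_cong[where f = card] Collect_cong) meson
qed

text \<open>The weighted sum over separating partitions of \<open>{1..n + r}\<close>, grouped by the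
  number of blocks in excess of \<open>r\<close>.\<close>

lemma sum_r_Stirling2_falling_fact:
  fixes t :: "'a::comm_ring_1"
  shows "(\<Sum>k\<le>n. of_nat (r_Stirling2 r (n + r) (k + r)) * falling_fact t k) = (t + of_nat r) ^ n"
proof -
  let ?S = "separating_partitions {1..n + r} {1..r}"
  have A: "{1..n + r} = {r + 1..n + r} \<union> {1..r}" by auto
  have fin: "finite ?S" by (simp add: finite_separating_partitions)
  have bounds: "r \<le> card P" "card P \<le> n + r" if P: "P \<in> ?S" for P
  proof -
    show "r \<le> card P"
      using card_le_card_separating_partition[OF _ _ P] by simp
    have part: "partition_on {1..n + r} P" using P by (simp add: separating_partitions_def)
    \<comment> \<open>Blocks are nonempty, so there are at most as many as elements; this bounds the
      group index by \<open>n\<close>.\<close>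
    have "(\<Sum>B\<in>P. 1) \<le> (\<Sum>B\<in>P. card B)"
    proof (rule sum_mono)
      fix B assume B: "B \<in> P"
      then have "B \<subseteq> {1..n + r}" "B \<noteq> {}"
        using partition_onD1[OF part] partition_onD3[OF part] by blast+
      then have "finite B" "B \<noteq> {}" by (auto dest: finite_subset)
      then show "1 \<le> card B" by (simp add: Suc_le_eq card_gt_0_iff)
    qed
    also have "\<dots> = card {1..n + r}"
      using partition_onD1[OF part]
      by (intro product_partition[OF part, symmetric])
         (metis Union_upper finite_atLeastAtMost finite_subset)
    finally show "card P \<le> n + r" by simp
  qed
  have "(\<Sum>k\<le>n. of_nat (r_Stirling2 r (n + r) (k + r)) * falling_fact t k) =
        (\<Sum>k\<le>n. \<Sum>P\<in>{P \<in> ?S. card P - r = k}. falling_fact t (card P - r))"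
  proof (rule sum.cong[OF refl])
    fix k
    \<comment> \<open>Since \<open>r \<le> card P\<close>, truncated subtraction puts no smaller
      partition into the group \<open>k = 0\<close>.\<close>
    have "{P \<in> ?S. card P - r = k} = {P \<in> ?S. card P = k + r}"
      using bounds by fastforce
    then show "of_nat (r_Stirling2 r (n + r) (k + r)) * falling_fact t k =
          (\<Sum>P\<in>{P \<in> ?S. card P - r = k}. falling_fact t (card P - r))"
      by (simp add: r_Stirling2_eq_card_separating_partitions)
  qed
  also have "\<dots> = (\<Sum>P\<in>?S. falling_fact t (card P - r))"
    using bounds by (intro sum.group[OF fin]) fastforce+
  also have "\<dots> = (t + of_nat r) ^ n"
    using sum_falling_fact_separating_partitions[of "{1..r}" "{r + 1..n + r}" t]
    by (subst A) simp
  finally show ?thesis .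
qed

section \<open>Falling factorials and factorials modulo p\<close>

text \<open>Among \<open>p\<close> consecutive integers one is a multiple of \<open>p\<close>: the
  factor indexed by the residue of \<open>t\<close>.\<close>

lemma dvd_falling_fact_self:
  assumes "p > 0"
  shows "int p dvd falling_fact t p"
proof -
  define i where "i = nat (t mod int p)"
  have "i < p" "int p dvd t - int i"
    using assms by (auto simp: i_def nat_less_iff)
  then show ?thesis
    unfolding falling_fact_def by (intro dvd_trans[OF _ dvd_prodI]) auto
qed

text \<open>Upper negation of binomial coefficients; the induction step is the absorption identity.
  Truncation of \<open>m + i - 1\<close> at \<open>m = i = 0\<close> is harmless, as the lower index
  is 0.\<close>

lemma falling_fact_uminus_eq_binomial:
  "falling_fact (- int m) i = (-1) ^ i * fact i * int ((m + i - 1) choose i)"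
proof (induction i)
  case (Suc i)
  let ?b = "int ((m + i - 1) choose i)" and ?b' = "int ((m + i) choose Suc i)"
  have absorb: "int (Suc i) * ?b' = int (m + i) * ?b"
    using binomial_absorption[of i "m + i"] by (metis of_nat_mult)
  have "falling_fact (- int m) (Suc i) = (-1) ^ Suc i * fact i * (int (m + i) * ?b)"
    by (simp add: falling_fact_Suc Suc algebra_simps)
  also have "\<dots> = (-1) ^ Suc i * fact (Suc i) * ?b'"
    unfolding absorb[symmetric] by simp
  finally show ?case by simp
qed simp

text \<open>Induction from Wilson's theorem: each step trades the factor \<open>p - 1 - i\<close>
  for \<open>-(i + 1)\<close>, which is congruent to it.\<close>

lemma wilson_fact_mult_fact:
  assumes "prime p" "i < p"
  shows "[(-1) ^ i * fact i * fact (p - 1 - i) = (-1::int)] (mod int p)"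
  using assms(2)
proof (induction i)
  case 0
  show ?case using wilson_theorem[OF assms(1)] by simp
next
  case (Suc i)
  obtain k where p: "p = i + k + 2" using Suc.prems less_imp_Suc_add[of "Suc i" p] by auto
  have "(-1) ^ Suc i * fact (Suc i) * fact (p - 1 - Suc i)
          = (-1) ^ i * fact i * fact (p - 1 - i) - int p * ((-1) ^ i * fact i * fact k)"
    by (simp add: p algebra_simps)
  also have "[(-1) ^ i * fact i * fact (p - 1 - i) - int p * ((-1) ^ i * fact i * fact k)
               = (-1) ^ i * fact i * fact (p - 1 - i)] (mod int p)"
    by (simp add: cong_iff_dvd_diff)
  also have "[(-1) ^ i * fact i * fact (p - 1 - i) = (-1::int)] (mod int p)"
    using Suc by simp
  finally show ?case .
qed

section \<open>The polynomials T in powers of x + 1\<close>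

lemma T_poly_0: "T_poly 0 m = 1"
  by (simp add: T_poly_def monom_0)

text \<open>Pascal's rule on each coefficient; the added constant supplies the neighbour that the
  constant term lacks.\<close>

lemma T_poly_Suc: "T_poly (Suc n) m = [:1, 1:] * T_poly n m + [:int ((m + n) choose Suc n):]"
proof (rule poly_eqI)
  fix j
  have coeff_T: "coeff (T_poly n m) j = int ((n + m) choose (j + m))" for n j
    by (auto simp: T_poly_def coeff_sum)
  show "coeff (T_poly (Suc n) m) j = coeff ([:1, 1:] * T_poly n m + [:int ((m + n) choose Suc n):]) j"
  proof (cases j)
    case 0
    \<comment> \<open>By symmetry the lower index \<open>Suc n\<close> stands for
      \<open>m - 1\<close>, and it gives the right value 0 when \<open>m = 0\<close>.\<close>
    have "(Suc (n + m)) choose m = ((n + m) choose m) + ((n + m) choose Suc n)"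
      using binomial_symmetric[of m "Suc (n + m)"] binomial_symmetric[of m "n + m"] by simp
    then show ?thesis by (simp add: 0 coeff_T add.commute)
  next
    case (Suc i)
    then show ?thesis by (simp add: coeff_T)
  qed
qed

text \<open>The recurrence is a Horner scheme in \<open>[:1, 1:]\<close>: the constant added on
  reaching index \<open>n - k\<close> is multiplied by it \<open>k\<close> more times.\<close>

lemma T_poly_eq_sum:
  "T_poly n m = (\<Sum>k\<le>n. smult (int ((m + (n - k) - 1) choose (n - k))) ([:1, 1:] ^ k))"
proof (induction n)
  case 0
  show ?case by (simp add: T_poly_0)
next
  case (Suc n)
  show ?case
    unfolding T_poly_Suc Suc sum.atMost_Suc_shift
    by (simp add: sum_distrib_left)
qed

section \<open>The factorial sums modulo p\<close>

lemma poly_cong_iff_dvd: "poly_cong p A B \<longleftrightarrow> [:int p:] dvd A - B"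
  by (simp add: poly_cong_def const_poly_dvd_iff cong_iff_dvd_diff)

lemma smult_sum_right: "smult c (\<Sum>i\<in>S. f i) = (\<Sum>i\<in>S. smult c (f i))"
  by (induction S rule: infinite_finite_induct) (auto simp: smult_add_right)

lemma dvd_smult_const: "c dvd d \<Longrightarrow> [:c:] dvd smult d q" for c :: int
  by (auto simp: const_poly_dvd_iff)

text \<open>\<open>B\<^sub>j\<close> of the outline, with \<open>[:1, 1:]\<close> for y.\<close>

definition fact_sum :: "nat \<Rightarrow> nat \<Rightarrow> nat \<Rightarrow> int poly" where
  "fact_sum p m j = (\<Sum>k<p. smult (falling_fact (- int m) (p - 1 - k) * fact (k + j)) ([:1, 1:] ^ k))"

lemma fact_sum_0_cong:
  assumes "prime p"
  shows "[:int p:] dvd fact_sum p m 0 + T_poly (p - 1) m"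
proof -
  have p: "p > 0" using assms prime_gt_0_nat by blast
  then have "{..p - 1} = {..<p}" by auto
  then have "fact_sum p m 0 + T_poly (p - 1) m = (\<Sum>k<p.
     smult (falling_fact (- int m) (p - 1 - k) * fact k
            + int ((m + (p - 1 - k) - 1) choose (p - 1 - k))) ([:1, 1:] ^ k))"
    by (simp add: fact_sum_def T_poly_eq_sum sum.distrib smult_add_left)
  also have "[:int p:] dvd \<dots>"
  proof (intro dvd_sum dvd_smult_const)
    fix k assume k: "k \<in> {..<p}"
    let ?i = "p - 1 - k"
    let ?b = "int ((m + ?i - 1) choose ?i)"
    \<comment> \<open>Here \<open>k = p - 1 - ?i\<close>, so the Wilson-type product
      applies.\<close>
    have "int p dvd ((-1) ^ ?i * fact ?i * fact k + 1)"
      using wilson_fact_mult_fact[OF assms, of ?i] k by (simp add: cong_iff_dvd_diff)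
    then have "int p dvd ((-1) ^ ?i * fact ?i * fact k + 1) * ?b" by simp
    also have "\<dots> = falling_fact (- int m) ?i * fact k + ?b"
      unfolding falling_fact_uminus_eq_binomial by (simp add: algebra_simps)
    finally show "int p dvd falling_fact (- int m) ?i * fact k + ?b" .
  qed
  finally show ?thesis .
qed

text \<open>Write x as y - 1: multiplication by y shifts the index, and the coefficients of equal
  powers of y then combine to multiples of \<open>p\<close>.\<close>

lemma fact_sum_Suc_cong:
  assumes "p > 0"
  shows "[:int p:] dvd [:0, 1:] * fact_sum p m (Suc j) - smult (- int m - int j) (fact_sum p m j)"
proof -
  let ?y = "[:1, 1:] :: int poly"
  let ?c = "\<lambda>i. falling_fact (- int m) i"
  \<comment> \<open>Chosen so that y times the \<open>k\<close>-th term of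
    \<open>fact_sum p m (Suc j)\<close> is \<open>?E (Suc k)\<close>; the shift costs only
    \<open>?E p - ?E 0\<close>.\<close>
  let ?E = "\<lambda>k. smult (?c (p - k) * fact (k + j)) (?y ^ k)"
  have "?y * fact_sum p m (Suc j) = (\<Sum>k<p. ?E (Suc k))"
    by (simp add: fact_sum_def sum_distrib_left)
  also have "\<dots> = (\<Sum>k<p. ?E k) + (?E p - ?E 0)"
    unfolding sum_lessThan_telescope[of ?E, symmetric] by (simp add: sum_subtractf)
  finally have shift: "?y * fact_sum p m (Suc j) = (\<Sum>k<p. ?E k) + (?E p - ?E 0)" .
  have "[:0, 1:] * fact_sum p m (Suc j) = ?y * fact_sum p m (Suc j) - fact_sum p m (Suc j)"
    by (simp add: algebra_simps)
  then have "[:0, 1:] * fact_sum p m (Suc j) - smult (- int m - int j) (fact_sum p m j)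
     = ((\<Sum>k<p. ?E k) - fact_sum p m (Suc j) - smult (- int m - int j) (fact_sum p m j)) + (?E p - ?E 0)"
    unfolding shift by simp
  also have "(\<Sum>k<p. ?E k) - fact_sum p m (Suc j) - smult (- int m - int j) (fact_sum p m j)
     = (\<Sum>k<p. smult (int p * (- ?c (p - 1 - k) * fact (k + j))) (?y ^ k))"
    unfolding fact_sum_def smult_sum_right sum_subtractf[symmetric]
  proof (rule sum.cong[OF refl])
    fix k assume "k \<in> {..<p}"
    then have "p - k = Suc (p - 1 - k)" "int (p - 1 - k) = int p - 1 - int k" by auto
    \<comment> \<open>Subtracting \<open>k + j + 1\<close> and \<open>- m - j\<close> from this last
      factor leaves exactly \<open>- p\<close>.\<close>
    then have c: "?c (p - k) = ?c (p - 1 - k) * (- int m - (int p - 1 - int k))"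
      by (simp add: falling_fact_Suc)
    show "?E k - smult (?c (p - 1 - k) * fact (k + Suc j)) (?y ^ k)
        - smult (- int m - int j) (smult (?c (p - 1 - k) * fact (k + j)) (?y ^ k))
        = smult (int p * (- ?c (p - 1 - k) * fact (k + j))) (?y ^ k)"
      unfolding c smult_smult smult_diff_left[symmetric]
      by (intro arg_cong2[where f = smult] refl) (simp add: algebra_simps)
  qed
  also have "[:int p:] dvd \<dots> + (?E p - ?E 0)"
  proof (intro dvd_add dvd_diff dvd_sum dvd_smult_const)
    have "p dvd fact (p + j)" using assms by (simp add: dvd_fact)
    then have "int p dvd fact (p + j)" by (metis int_dvd_int_iff of_nat_fact)
    then show "int p dvd ?c (p - p) * fact (p + j)" by simp
    show "int p dvd ?c (p - 0) * fact (0 + j)"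
      using dvd_falling_fact_self[OF assms] by simp
  qed simp
  finally show ?thesis .
qed

text \<open>Iterating the one-step congruence accumulates the factors \<open>- m - j\<close> into a
  falling factorial.\<close>

lemma monom_fact_sum_cong:
  assumes "p > 0"
  shows "[:int p:] dvd monom 1 j * fact_sum p m j - smult (falling_fact (- int m) j) (fact_sum p m 0)"
proof (induction j)
  case (Suc j)
  let ?F = "fact_sum p m" and ?c = "falling_fact (- int m)"
  \<comment> \<open>The one-step congruence times the \<open>j\<close>-th power of x, plus
    \<open>- m - j\<close> times the induction hypothesis.\<close>
  have "monom 1 (Suc j) * ?F (Suc j) - smult (?c (Suc j)) (?F 0)
     = monom 1 j * ([:0, 1:] * ?F (Suc j) - smult (- int m - int j) (?F j))
       + smult (- int m - int j) (monom 1 j * ?F j - smult (?c j) (?F 0))"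
    by (simp add: monom_Suc falling_fact_Suc smult_diff_right right_diff_distrib mult.commute)
  then show ?case
    using fact_sum_Suc_cong[OF assms, of m j] Suc by (simp add: dvd_smult)
qed simp

section \<open>The congruence for the Fubini polynomials\<close>

theorem theorem18:
  fixes n m r p :: nat
  assumes "prime p"
  shows "poly_cong p
           (\<Sum>k=0..p - 1. smult (falling_fact (- int m) (p - 1 - k))
                            ([:1, 1:] ^ k * Fubini_poly n (r + m) k))
           (- smult (int r ^ n) (T_poly (p - 1) m))"
proof -
  let ?F = "fact_sum p m" and ?c = "falling_fact (- int m)"
  let ?S = "\<lambda>j. int (r_Stirling2 (r + m) (n + (r + m)) (j + (r + m)))"
  have p: "p > 0" using assms prime_gt_0_nat by blast
  then have "{0..p - 1} = {..<p}" by auto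
  then have "(\<Sum>k=0..p - 1. smult (?c (p - 1 - k)) ([:1, 1:] ^ k * Fubini_poly n (r + m) k))
     = (\<Sum>k<p. \<Sum>j\<le>n. smult (?S j) (monom 1 j * smult (?c (p - 1 - k) * fact (k + j)) ([:1, 1:] ^ k)))"
    unfolding Fubini_poly_def sum_distrib_left smult_sum_right
  proof (intro sum.cong refl)
    fix k j
    have "monom (?S j * fact (j + k)) j = smult (?S j * fact (k + j)) (monom 1 j)"
      by (simp add: smult_monom add.commute)
    then show "smult (?c (p - 1 - k)) ([:1, 1:] ^ k * monom (?S j * fact (j + k)) j)
      = smult (?S j) (monom 1 j * smult (?c (p - 1 - k) * fact (k + j)) ([:1, 1:] ^ k))"
      by (simp add: mult_ac)
  qed simp
  also have "\<dots> = (\<Sum>j\<le>n. smult (?S j) (monom 1 j * ?F j))"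
    unfolding fact_sum_def sum_distrib_left smult_sum_right by (rule sum.swap)
  finally have lhs: "(\<Sum>k=0..p - 1. smult (?c (p - 1 - k)) ([:1, 1:] ^ k * Fubini_poly n (r + m) k))
     = (\<Sum>j\<le>n. smult (?S j) (monom 1 j * ?F j))" .
  \<comment> \<open>At \<open>t = - m\<close> the base \<open>t + (r + m)\<close> reduces to
    \<open>r\<close>.\<close>
  have "(\<Sum>j\<le>n. ?S j * ?c j) = int r ^ n"
    using sum_r_Stirling2_falling_fact[of "r + m" n "- int m"] by simp
  then have "smult (int r ^ n) (?F 0) = (\<Sum>j\<le>n. smult (?S j) (smult (?c j) (?F 0)))"
    by (simp add: smult_sum[symmetric])
  \<comment> \<open>The difference splits into the errors of reducing each \<open>?F j\<close> to
    \<open>?F 0\<close> and of replacing \<open>?F 0\<close> by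
    \<open>- T_poly (p - 1) m\<close>.\<close>
  then have "(\<Sum>j\<le>n. smult (?S j) (monom 1 j * ?F j)) - (- smult (int r ^ n) (T_poly (p - 1) m))
     = (\<Sum>j\<le>n. smult (?S j) (monom 1 j * ?F j - smult (?c j) (?F 0)))
       + smult (int r ^ n) (?F 0 + T_poly (p - 1) m)"
    by (simp add: smult_diff_right sum_subtractf smult_add_right)
  also have "[:int p:] dvd \<dots>"
    by (intro dvd_add dvd_sum dvd_smult monom_fact_sum_cong[OF p] fact_sum_0_cong[OF assms])
  finally show ?thesis
    unfolding poly_cong_iff_dvd lhs .
qed

end
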